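(* Let $k$ be a constant and $f(r)=\dfrac{\sin^2r}{\left[1+(\ln\tan\frac r2)^2\right]^2}$, $0<r<\pi$. The rotationally symmetric map $\varphi:(S^2\setminus\{N,S\},dr^2+\sin^2r\,d\theta^2)\longrightarrow(N^2,d\rho^2+\rho\,d\phi^2)$ with $\varphi(r,\theta)=(\rho(r),k\theta)$ is an $f$-biharmonic map if and only if $$\rho(r)=C_4+C_3\ln\tan\tfrac r2+\left(\tfrac{C_1}{2}+\tfrac{k^2}{4}\right)\left(\ln\tan\tfrac r2\right)^2+\tfrac{C_2}{6}\left(\ln\tan\tfrac r2\right)^3+\tfrac{C_1}{6}\left(\ln\tan\tfrac r2\right)^4+\tfrac{C_2}{10}\left(\ln\tan\tfrac r2\right)^5+\tfrac{C_1}{30}\left(\ln\tan\tfrac r2\right)^6+\tfrac{C_2}{42}\left(\ln\tan\tfrac r2\right)^7$$ for some constants $C_1,C_2,C_3,C_4$. In particular, the rotationally symmetric map $\varphi:(S^2\setminus\{N,S\},dr^2+\sin^2r\,d\theta^2)\longrightarrow(N^2,d\rho^2+\rho\,d\phi^2)$, $\varphi(r,\theta)=(\rho(r),k\theta)$ with $$\rho(r)=\tfrac1{30}\left(\ln\tan\tfrac r2\right)^6+\tfrac16\left(\ln\tan\tfrac r2\right)^4+\left(\tfrac12+\tfrac14k^2\right)\left(\ln\tan\tfrac r2\right)^2+1$$ is a proper $f$-biharmonic map for this $f$.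
   Context: For a smooth map $\phi:(M,g)\to(N,h)$ of Riemannian manifolds, $\tau(\phi)=\mathrm{Tr}_g\nabla d\phi$ is the tension field and $\tau_2(\phi)=\mathrm{Trace}_g(\nabla^\phi\nabla^\phi-\nabla^\phi_{\nabla^M})\tau(\phi)-\mathrm{Trace}_g R^N(d\phi,\tau(\phi))d\phi$ is the bitension field, with $R^N(X,Y)Z=[\nabla^N_X,\nabla^N_Y]Z-\nabla^N_{[X,Y]}Z$. The map is harmonic if $\tau(\phi)=0$ and biharmonic if $\tau_2(\phi)=0$. For a positive smooth function $f$ on $M$, it is $f$-biharmonic if $f\tau_2(\phi)+(\Delta f)\tau(\phi)+2\nabla^\phi_{\mathrm{grad} f}\tau(\phi)=0$, and proper $f$-biharmonic if it is $f$-biharmonic but neither harmonic nor biharmonic. $(r,\theta)$, $0<r<\pi$, are geodesic polar coordinates on the unit sphere with poles $N,S$. $N^2$ is the surface with coordinates $(\rho,\phi)$, $\rho>0$, $\phi$ angular, and metric $d\rho^2+\rho\,d\phi^2$; $\rho(r)$ is a positive smooth function. When $k$ is not an integer the statement is understood in local coordinates (locally in $\theta$). *)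

theory Defs
  imports "HOL-Analysis.Analysis"
begin

text \<open>
  Riemannian geometry in a coordinate chart: a chart is an open set of points of
  \<^typ>\<open>real^'n\<close>, a metric is its Gram matrix in the coordinate frame, and tangent vectors and
  vector fields are given by their components in that frame.
\<close>

section \<open>Smooth maps\<close>

primrec iterated_derivative ::
    "'a::real_normed_vector list \<Rightarrow> ('a \<Rightarrow> 'b::real_normed_vector) \<Rightarrow> 'a \<Rightarrow> 'b" where
  "iterated_derivative [] F = F"
| "iterated_derivative (v # vs) F = (\<lambda>x. frechet_derivative (iterated_derivative vs F) (at x) v)"

text \<open>
  Meant for open \<^term>\<open>U\<close> in a finite-dimensional space, where it says that \<^term>\<open>F\<close> is
  infinitely often differentiable on \<^term>\<open>U\<close>.
\<close>

definition smooth_on :: "'a::euclidean_space set \<Rightarrow> ('a \<Rightarrow> 'b::real_normed_vector) \<Rightarrow> bool" where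
  "smooth_on U F \<longleftrightarrow> (\<forall>vs. \<forall>x\<in>U. iterated_derivative vs F differentiable (at x))"

section \<open>Metric, Levi-Civita connection, curvature\<close>

type_synonym 'n metric = "real^'n \<Rightarrow> real^'n^'n"

definition riemannian_chart :: "(real^'n) set \<Rightarrow> 'n::finite metric \<Rightarrow> bool" where
  "riemannian_chart U g \<longleftrightarrow>
     open U \<and> U \<noteq> {} \<and> smooth_on U g \<and>
     (\<forall>x\<in>U. transpose (g x) = g x \<and> (\<forall>v. v \<noteq> 0 \<longrightarrow> v \<bullet> (g x *v v) > 0))"

definition partial :: "'n::finite \<Rightarrow> (real^'n \<Rightarrow> 'b::real_normed_vector) \<Rightarrow> real^'n \<Rightarrow> 'b" where
  "partial i F x = frechet_derivative F (at x) (axis i 1)"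

definition christoffel :: "'n::finite metric \<Rightarrow> real^'n \<Rightarrow> 'n \<Rightarrow> 'n \<Rightarrow> 'n \<Rightarrow> real" where
  "christoffel g x k i j = (1/2) * (\<Sum>l\<in>UNIV. matrix_inv (g x) $ k $ l *
     (partial i (\<lambda>y. g y $ j $ l) x + partial j (\<lambda>y. g y $ i $ l) x
      - partial l (\<lambda>y. g y $ i $ j) x))"

definition connection_form :: "'n::finite metric \<Rightarrow> real^'n \<Rightarrow> real^'n \<Rightarrow> real^'n \<Rightarrow> real^'n" where
  "connection_form g x u v =
     (\<chi> k. \<Sum>i\<in>UNIV. \<Sum>j\<in>UNIV. christoffel g x k i j * u $ i * v $ j)"

definition covariant :: "'n::finite metric \<Rightarrow> real^'n \<Rightarrow> (real^'n \<Rightarrow> real^'n) \<Rightarrow> real^'n \<Rightarrow> real^'n" where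
  "covariant g u Y x = frechet_derivative Y (at x) u + connection_form g x u (Y x)"

definition lie_bracket ::
    "(real^'n::finite \<Rightarrow> real^'n) \<Rightarrow> (real^'n \<Rightarrow> real^'n) \<Rightarrow> real^'n \<Rightarrow> real^'n" where
  "lie_bracket X Y x = frechet_derivative Y (at x) (X x) - frechet_derivative X (at x) (Y x)"

definition curvature_field ::
    "'n::finite metric \<Rightarrow> (real^'n \<Rightarrow> real^'n) \<Rightarrow> (real^'n \<Rightarrow> real^'n) \<Rightarrow> (real^'n \<Rightarrow> real^'n) \<Rightarrow>
     real^'n \<Rightarrow> real^'n" where
  "curvature_field g X Y Z x =
     covariant g (X x) (\<lambda>y. covariant g (Y y) Z y) x
     - covariant g (Y x) (\<lambda>y. covariant g (X y) Z y) x
     - covariant g (lie_bracket X Y x) Z x"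

text \<open>
  The curvature is tensorial, so its value on tangent vectors at a point may be computed from any
  extensions to vector fields; here they are extended with constant components.
\<close>

definition curvature :: "'n::finite metric \<Rightarrow> real^'n \<Rightarrow> real^'n \<Rightarrow> real^'n \<Rightarrow> real^'n \<Rightarrow> real^'n" where
  "curvature g x u v w = curvature_field g (\<lambda>_. u) (\<lambda>_. v) (\<lambda>_. w) x"

definition metric_trace ::
    "'n::finite metric \<Rightarrow> real^'n \<Rightarrow> (real^'n \<Rightarrow> real^'n \<Rightarrow> 'b::real_vector) \<Rightarrow> 'b" where
  "metric_trace g x B =
     (\<Sum>i\<in>UNIV. \<Sum>j\<in>UNIV. (matrix_inv (g x) $ i $ j) *\<^sub>R B (axis i 1) (axis j 1))"

section \<open>Functions on a chart\<close>

definition gradient :: "'n::finite metric \<Rightarrow> (real^'n \<Rightarrow> real) \<Rightarrow> real^'n \<Rightarrow> real^'n" where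
  "gradient g f x = (\<chi> i. \<Sum>j\<in>UNIV. matrix_inv (g x) $ i $ j * partial j f x)"

text \<open>Sign convention: the trace of the Hessian, i.e. the divergence of the gradient.\<close>

definition laplacian :: "'n::finite metric \<Rightarrow> (real^'n \<Rightarrow> real) \<Rightarrow> real^'n \<Rightarrow> real" where
  "laplacian g f x = metric_trace g x (\<lambda>u v.
     frechet_derivative (\<lambda>y. frechet_derivative f (at y) v) (at x) u
     - frechet_derivative f (at x) (covariant g u (\<lambda>_. v) x))"

section \<open>Maps between charts\<close>

abbreviation differential :: "(real^'m::finite \<Rightarrow> real^'n::finite) \<Rightarrow> real^'m \<Rightarrow> real^'m \<Rightarrow> real^'n" where
  "differential \<phi> x \<equiv> frechet_derivative \<phi> (at x)"

text \<open>
  The pull-back connection on sections \<^term>\<open>V\<close> of the pull-back of the tangent bundle of the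
  target, whose metric is \<^term>\<open>h\<close>, along \<^term>\<open>\<phi>\<close>.
\<close>

definition pullback_covariant ::
    "'n::finite metric \<Rightarrow> (real^'m::finite \<Rightarrow> real^'n) \<Rightarrow> real^'m \<Rightarrow> (real^'m \<Rightarrow> real^'n) \<Rightarrow>
     real^'m \<Rightarrow> real^'n" where
  "pullback_covariant h \<phi> u V x =
     frechet_derivative V (at x) u + connection_form h (\<phi> x) (differential \<phi> x u) (V x)"

definition second_fundamental_form ::
    "'m::finite metric \<Rightarrow> 'n::finite metric \<Rightarrow> (real^'m \<Rightarrow> real^'n) \<Rightarrow> real^'m \<Rightarrow>
     real^'m \<Rightarrow> real^'m \<Rightarrow> real^'n" where
  "second_fundamental_form g h \<phi> x u v =
     pullback_covariant h \<phi> u (\<lambda>y. differential \<phi> y v) x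
     - differential \<phi> x (covariant g u (\<lambda>_. v) x)"

definition tension ::
    "'m::finite metric \<Rightarrow> 'n::finite metric \<Rightarrow> (real^'m \<Rightarrow> real^'n) \<Rightarrow> real^'m \<Rightarrow> real^'n" where
  "tension g h \<phi> x = metric_trace g x (second_fundamental_form g h \<phi> x)"

definition rough_laplacian ::
    "'m::finite metric \<Rightarrow> 'n::finite metric \<Rightarrow> (real^'m \<Rightarrow> real^'n) \<Rightarrow> (real^'m \<Rightarrow> real^'n) \<Rightarrow>
     real^'m \<Rightarrow> real^'n" where
  "rough_laplacian g h \<phi> V x = metric_trace g x (\<lambda>u v.
     pullback_covariant h \<phi> u (\<lambda>y. pullback_covariant h \<phi> v V y) x
     - pullback_covariant h \<phi> (covariant g u (\<lambda>_. v) x) V x)"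

definition bitension ::
    "'m::finite metric \<Rightarrow> 'n::finite metric \<Rightarrow> (real^'m \<Rightarrow> real^'n) \<Rightarrow> real^'m \<Rightarrow> real^'n" where
  "bitension g h \<phi> x =
     rough_laplacian g h \<phi> (tension g h \<phi>) x
     - metric_trace g x (\<lambda>u v.
         curvature h (\<phi> x) (differential \<phi> x u) (tension g h \<phi> x) (differential \<phi> x v))"

definition smooth_map ::
    "(real^'m) set \<Rightarrow> 'm::finite metric \<Rightarrow> (real^'n) set \<Rightarrow> 'n::finite metric \<Rightarrow>
     (real^'m \<Rightarrow> real^'n) \<Rightarrow> bool" where
  "smooth_map U g V h \<phi> \<longleftrightarrow>
     riemannian_chart U g \<and> riemannian_chart V h \<and> smooth_on U \<phi> \<and> \<phi> ` U \<subseteq> V"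

definition harmonic ::
    "(real^'m) set \<Rightarrow> 'm::finite metric \<Rightarrow> (real^'n) set \<Rightarrow> 'n::finite metric \<Rightarrow>
     (real^'m \<Rightarrow> real^'n) \<Rightarrow> bool" where
  "harmonic U g V h \<phi> \<longleftrightarrow> smooth_map U g V h \<phi> \<and> (\<forall>x\<in>U. tension g h \<phi> x = 0)"

definition biharmonic ::
    "(real^'m) set \<Rightarrow> 'm::finite metric \<Rightarrow> (real^'n) set \<Rightarrow> 'n::finite metric \<Rightarrow>
     (real^'m \<Rightarrow> real^'n) \<Rightarrow> bool" where
  "biharmonic U g V h \<phi> \<longleftrightarrow> smooth_map U g V h \<phi> \<and> (\<forall>x\<in>U. bitension g h \<phi> x = 0)"

definition f_biharmonic ::
    "(real^'m) set \<Rightarrow> 'm::finite metric \<Rightarrow> (real^'n) set \<Rightarrow> 'n::finite metric \<Rightarrow>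
     (real^'m \<Rightarrow> real) \<Rightarrow> (real^'m \<Rightarrow> real^'n) \<Rightarrow> bool" where
  "f_biharmonic U g V h f \<phi> \<longleftrightarrow>
     smooth_map U g V h \<phi> \<and> smooth_on U f \<and> (\<forall>x\<in>U. f x > 0) \<and>
     (\<forall>x\<in>U. f x *\<^sub>R bitension g h \<phi> x + laplacian g f x *\<^sub>R tension g h \<phi> x
       + 2 *\<^sub>R pullback_covariant h \<phi> (gradient g f x) (tension g h \<phi>) x = 0)"

definition proper_f_biharmonic ::
    "(real^'m) set \<Rightarrow> 'm::finite metric \<Rightarrow> (real^'n) set \<Rightarrow> 'n::finite metric \<Rightarrow>
     (real^'m \<Rightarrow> real) \<Rightarrow> (real^'m \<Rightarrow> real^'n) \<Rightarrow> bool" where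
  "proper_f_biharmonic U g V h f \<phi> \<longleftrightarrow>
     f_biharmonic U g V h f \<phi> \<and> \<not> harmonic U g V h \<phi> \<and> \<not> biharmonic U g V h \<phi>"

section \<open>The two surfaces and rotationally symmetric maps\<close>

text \<open>
  The twice-punctured unit sphere in geodesic polar coordinates \<^term>\<open>(r, \<theta>)\<close>, with
  \<^term>\<open>\<theta>\<close> ranging over \<^term>\<open>I\<close>; the whole line is the universal cover.
\<close>

definition sphere_chart :: "real set \<Rightarrow> (real^2) set" where
  "sphere_chart I = {x. 0 < x $ 1 \<and> x $ 1 < pi \<and> x $ 2 \<in> I}"

definition sphere_metric :: "2 metric" where
  "sphere_metric x = vector [vector [1, 0], vector [0, (sin (x $ 1))\<^sup>2]]"

text \<open>
  The angular coordinate of the target ranges over the whole line (universal cover), so that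
  \<^term>\<open>k * \<theta>\<close> need not be reduced modulo \<^term>\<open>2 * pi\<close>.
\<close>

definition target_chart :: "(real^2) set" where
  "target_chart = {y. 0 < y $ 1}"

definition target_metric :: "2 metric" where
  "target_metric y = vector [vector [1, 0], vector [0, y $ 1]]"

definition rotational_map :: "(real \<Rightarrow> real) \<Rightarrow> real \<Rightarrow> real^2 \<Rightarrow> real^2" where
  "rotational_map \<rho> k x = vector [\<rho> (x $ 1), k * x $ 2]"

end

theory Submission
  imports Defs
begin

text \<open>
  Let \<open>t = ln (tan (r / 2))\<close>, so that \<open>dt/dr = 1 / sin r\<close>. The sphere metric is
  \<open>sin\<^sup>2 r (dt\<^sup>2 + d\<theta>\<^sup>2)\<close>, hence on functions of \<open>r\<close> alone the Laplacian
  \<open>L w = w'' + cot r w'\<close> is the second \<open>t\<close>-derivative divided by \<open>sin\<^sup>2 r\<close>. In particular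
  \<open>L w = 0\<close> exactly when \<open>w\<close> is affine in \<open>t\<close>.

  For the rotational map with profile \<open>\<rho>\<close> the tension field is radial, with component
  \<open>X = L \<rho> - k\<^sup>2 / (2 sin\<^sup>2 r)\<close>. The target metric \<open>d\<rho>\<^sup>2 + \<rho> d\<phi>\<^sup>2\<close> is special in that its
  coefficient is linear in \<open>\<rho>\<close>: the zeroth-order term produced by the rough Laplacian
  cancels against the curvature term, so the bitension field is radial with component \<open>L X\<close>. By
  the product rule for \<open>L\<close>, the \<open>f\<close>-biharmonic equation becomes \<open>L (f X) = 0\<close>.

  Consequently \<open>f X = C\<^sub>1 + C\<^sub>2 t\<close>. With \<open>f = sin\<^sup>2 r / (1 + t\<^sup>2)\<^sup>2\<close> this reads
  \<open>d\<^sup>2\<rho>/dt\<^sup>2 = k\<^sup>2 / 2 + (C\<^sub>1 + C\<^sub>2 t) (1 + t\<^sup>2)\<^sup>2\<close>, whose right-hand side has the polynomial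
  second antiderivative \<open>profile k C\<^sub>1 C\<^sub>2\<close>; the difference between \<open>\<rho>\<close> and it is again
  affine in \<open>t\<close>, which contributes \<open>C\<^sub>3\<close> and \<open>C\<^sub>4\<close>. Every step is an equivalence.

  In the example \<open>C\<^sub>1 = 1\<close> and \<open>C\<^sub>2 = 0\<close>, so \<open>X = (1 + t\<^sup>2)\<^sup>2 / sin\<^sup>2 r\<close>. On the equator
  \<open>X = 1\<close> and \<open>L X = 6\<close>, so the map is neither harmonic nor biharmonic.
\<close>

section \<open>Calculus of smooth functions\<close>

lemma iterated_derivative_snoc:
  "iterated_derivative (vs @ [v]) F = iterated_derivative vs (\<lambda>x. frechet_derivative F (at x) v)"
  by (induction vs) auto

lemma smooth_on_differentiable: "smooth_on U F \<Longrightarrow> x \<in> U \<Longrightarrow> F differentiable at x"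
  unfolding smooth_on_def by (metis iterated_derivative.simps(1))

lemma smooth_on_frechet_derivative:
  "smooth_on U F \<Longrightarrow> smooth_on U (\<lambda>x. frechet_derivative F (at x) v)"
  unfolding smooth_on_def by (metis iterated_derivative_snoc)

lemma differentiable_transform_open:
  assumes "F differentiable at x" "x \<in> U" "open U" "\<And>y. y \<in> U \<Longrightarrow> F y = G y"
  shows "G differentiable at x"
  using assms has_derivative_transform_within_open unfolding differentiable_def by blast

text \<open>
  Smoothness is the largest property of functions that implies differentiability and is
  inherited by directional derivatives. It is enough that the derivatives agree on the open set with
  functions having the property, because the derivatives at its points do not see the outside.
\<close>

lemma smooth_on_coinduct:
  assumes U: "open U" and F: "P F"
    and step: "\<And>F x. P F \<Longrightarrow> x \<in> U \<Longrightarrow> F differentiable at x"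
      "\<And>F v. P F \<Longrightarrow> \<exists>G. P G \<and> (\<forall>x\<in>U. frechet_derivative F (at x) v = G x)"
  shows "smooth_on U F"
proof -
  have "\<exists>G. P G \<and> (\<forall>x\<in>U. iterated_derivative vs F x = G x)" for vs
  proof (induction vs)
    case Nil
    show ?case using F by auto
  next
    case (Cons v vs)
    then obtain G where G: "P G" "\<forall>x\<in>U. iterated_derivative vs F x = G x" by blast
    obtain H where H: "P H" "\<forall>x\<in>U. frechet_derivative G (at x) v = H x"
      using step(2) [OF G(1)] by blast
    have "frechet_derivative (iterated_derivative vs F) (at x) v = H x" if x: "x \<in> U" for x
    proof -
      have "frechet_derivative G (at x) = frechet_derivative (iterated_derivative vs F) (at x)"
        by (rule frechet_derivative_transform_within_open [OF step(1) [OF G(1) x] U x])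
           (simp add: G)
      then show ?thesis using H x by metis
    qed
    then show ?case using H(1) by auto
  qed
  then have *: "\<exists>G. P G \<and> (\<forall>x\<in>U. iterated_derivative vs F x = G x)" for vs .
  show ?thesis
    unfolding smooth_on_def
  proof (intro allI ballI)
    fix vs x assume x: "x \<in> U"
    obtain G where G: "P G" "\<forall>x\<in>U. iterated_derivative vs F x = G x" using * by blast
    show "iterated_derivative vs F differentiable at x"
      by (rule differentiable_transform_open [OF step(1) [OF G(1) x] x U]) (simp add: G)
  qed
qed

lemma smooth_on_cong:
  assumes U: "open U" and F: "smooth_on U F" and eq: "\<And>x. x \<in> U \<Longrightarrow> F x = G x"
  shows "smooth_on U G"
proof (rule smooth_on_coinduct [where P = "\<lambda>G. \<exists>F. smooth_on U F \<and> (\<forall>x\<in>U. F x = G x)"])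
  show "\<exists>F. smooth_on U F \<and> (\<forall>x\<in>U. F x = G x)" using F eq by blast
next
  fix G :: "'a \<Rightarrow> 'b" and x
  assume "\<exists>F. smooth_on U F \<and> (\<forall>x\<in>U. F x = G x)" and x: "x \<in> U"
  then obtain F where F: "smooth_on U F" "\<forall>x\<in>U. F x = G x" by blast
  show "G differentiable at x"
    by (rule differentiable_transform_open [OF smooth_on_differentiable [OF F(1) x] x U])
       (simp add: F)
next
  fix G :: "'a \<Rightarrow> 'b" and v
  assume "\<exists>F. smooth_on U F \<and> (\<forall>x\<in>U. F x = G x)"
  then obtain F where F: "smooth_on U F" "\<forall>x\<in>U. F x = G x" by blast
  have "frechet_derivative F (at x) = frechet_derivative G (at x)" if x: "x \<in> U" for x
    by (rule frechet_derivative_transform_within_open [OF smooth_on_differentiable [OF F(1) x] U x])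
       (simp add: F)
  then show "\<exists>H. (\<exists>F. smooth_on U F \<and> (\<forall>x\<in>U. F x = H x)) \<and>
      (\<forall>x\<in>U. frechet_derivative G (at x) v = H x)"
    using smooth_on_frechet_derivative [OF F(1), of v] by auto
qed (use U in auto)

lemma smooth_on_const: "open U \<Longrightarrow> smooth_on U (\<lambda>x. c)"
  by (rule smooth_on_coinduct [where P = "\<lambda>F. \<exists>c. F = (\<lambda>x. c)"])
     (auto simp: frechet_derivative_const)

lemma smooth_onI_has_derivative:
  assumes U: "open U" and F: "\<And>x. x \<in> U \<Longrightarrow> (F has_derivative F' x) (at x)"
    and F': "\<And>v. smooth_on U (\<lambda>x. F' x v)"
  shows "smooth_on U F"
proof -
  have fd: "frechet_derivative F (at x) = F' x" if "x \<in> U" for x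
    using frechet_derivative_at [OF F [OF that]] by simp
  have diff: "F differentiable at x" if "x \<in> U" for x
    using F [OF that] by (auto simp: differentiable_def)
  show ?thesis
  proof (rule smooth_on_coinduct [where P = "\<lambda>G. G = F \<or> smooth_on U G", OF U])
    show "G differentiable at x" if "G = F \<or> smooth_on U G" "x \<in> U" for G x
      using that by (auto intro: diff smooth_on_differentiable)
    show "\<exists>H. (H = F \<or> smooth_on U H) \<and> (\<forall>x\<in>U. frechet_derivative G (at x) v = H x)"
      if "G = F \<or> smooth_on U G" for G v
    proof (cases "G = F")
      case True
      then show ?thesis using F' fd by auto
    next
      case False
      then show ?thesis using that smooth_on_frechet_derivative by blast
    qed
  qed simp
qed

lemma smooth_on_bounded_linear:
  assumes "open U" and "bounded_linear L"
  shows "smooth_on U L"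
  by (rule smooth_onI_has_derivative [where F' = "\<lambda>x. L"])
     (auto intro: assms bounded_linear_imp_has_derivative smooth_on_const)

lemma smooth_on_add:
  assumes U: "open U" and FG: "smooth_on U F" "smooth_on U G"
  shows "smooth_on U (\<lambda>x. F x + G x)"
proof (rule smooth_on_coinduct [where
      P = "\<lambda>H. \<exists>F G. smooth_on U F \<and> smooth_on U G \<and> H = (\<lambda>x. F x + G x)"])
  fix H :: "'a \<Rightarrow> 'b" and x
  assume "\<exists>F G. smooth_on U F \<and> smooth_on U G \<and> H = (\<lambda>x. F x + G x)" "x \<in> U"
  then show "H differentiable at x"
    by (auto intro: differentiable_add smooth_on_differentiable)
next
  fix H :: "'a \<Rightarrow> 'b" and v
  assume "\<exists>F G. smooth_on U F \<and> smooth_on U G \<and> H = (\<lambda>x. F x + G x)"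
  then obtain F G where FG: "smooth_on U F" "smooth_on U G" and H: "H = (\<lambda>x. F x + G x)" by blast
  have "frechet_derivative H (at x) v
      = frechet_derivative F (at x) v + frechet_derivative G (at x) v" if x: "x \<in> U" for x
  proof -
    have "(H has_derivative (\<lambda>v. frechet_derivative F (at x) v + frechet_derivative G (at x) v)) (at x)"
      unfolding H using FG x
      by (intro has_derivative_add) (auto simp flip: frechet_derivative_works intro: smooth_on_differentiable)
    from frechet_derivative_at [OF this] show ?thesis by metis
  qed
  then show "\<exists>K. (\<exists>F G. smooth_on U F \<and> smooth_on U G \<and> K = (\<lambda>x. F x + G x)) \<and>
      (\<forall>x\<in>U. frechet_derivative H (at x) v = K x)"
    using smooth_on_frechet_derivative [OF FG(1), of v] smooth_on_frechet_derivative [OF FG(2), of v]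
    by (intro exI [of _ "\<lambda>x. frechet_derivative F (at x) v + frechet_derivative G (at x) v"]) auto
qed (use U FG in auto)

text \<open>
  The derivative of a product or a reciprocal is not of the same shape as the function, but it stays
  within the closure of the smooth functions under all three operations, so that one coinduction
  covers them all.
\<close>

inductive smooth_generated :: "'a::euclidean_space set \<Rightarrow> ('a \<Rightarrow> real) \<Rightarrow> bool" for U where
  base: "smooth_on U F \<Longrightarrow> smooth_generated U F"
| add: "smooth_generated U F \<Longrightarrow> smooth_generated U G \<Longrightarrow> smooth_generated U (\<lambda>x. F x + G x)"
| mult: "smooth_generated U F \<Longrightarrow> smooth_generated U G \<Longrightarrow> smooth_generated U (\<lambda>x. F x * G x)"
| inverse: "smooth_generated U F \<Longrightarrow> (\<And>x. x \<in> U \<Longrightarrow> F x \<noteq> 0) \<Longrightarrow>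
    smooth_generated U (\<lambda>x. inverse (F x))"

lemma smooth_generated_derivative:
  assumes U: "open U" and "smooth_generated U F"
  shows "\<exists>F'. (\<forall>x\<in>U. (F has_derivative F' x) (at x)) \<and> (\<forall>v. smooth_generated U (\<lambda>x. F' x v))"
  using assms(2)
proof induction
  case (base F)
  then show ?case
    by (intro exI [of _ "\<lambda>x. frechet_derivative F (at x)"])
       (auto simp flip: frechet_derivative_works
         intro: smooth_generated.base smooth_on_differentiable smooth_on_frechet_derivative)
next
  case (add F G)
  then obtain F' G' where
    "\<forall>x\<in>U. (F has_derivative F' x) (at x)" "\<forall>v. smooth_generated U (\<lambda>x. F' x v)"
    "\<forall>x\<in>U. (G has_derivative G' x) (at x)" "\<forall>v. smooth_generated U (\<lambda>x. G' x v)" by blast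
  then show ?case
    by (intro exI [of _ "\<lambda>x v. F' x v + G' x v"])
       (auto intro: smooth_generated.add has_derivative_add)
next
  case (mult F G)
  then obtain F' G' where
    "\<forall>x\<in>U. (F has_derivative F' x) (at x)" "\<forall>v. smooth_generated U (\<lambda>x. F' x v)"
    "\<forall>x\<in>U. (G has_derivative G' x) (at x)" "\<forall>v. smooth_generated U (\<lambda>x. G' x v)" by blast
  moreover from this mult.hyps
  have "smooth_generated U (\<lambda>x. F x * G' x v)" "smooth_generated U (\<lambda>x. F' x v * G x)" for v
    by (auto intro: smooth_generated.mult)
  ultimately show ?case
    by (intro exI [of _ "\<lambda>x v. F x * G' x v + F' x v * G x"])
       (auto intro: smooth_generated.add has_derivative_mult)
next
  case (inverse F)
  then obtain F' where
    F': "\<forall>x\<in>U. (F has_derivative F' x) (at x)" "\<forall>v. smooth_generated U (\<lambda>x. F' x v)" by blast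
  have "smooth_generated U (\<lambda>x. inverse (F x))"
    using inverse by (intro smooth_generated.inverse) auto
  then have "smooth_generated U (\<lambda>x. (-1) * (inverse (F x) * F' x v * inverse (F x)))" for v
    using F' by (intro smooth_generated.mult smooth_generated.base [OF smooth_on_const [OF U]]) auto
  then have "smooth_generated U (\<lambda>x. - (inverse (F x) * F' x v * inverse (F x)))" for v
    by simp
  with F' inverse.hyps show ?case
    by (intro exI [of _ "\<lambda>x v. - (inverse (F x) * F' x v * inverse (F x))"])
       (auto intro: has_derivative_inverse)
qed

lemma smooth_generated_imp_smooth_on:
  assumes U: "open U" and F: "smooth_generated U F"
  shows "smooth_on U F"
proof (rule smooth_on_coinduct [where P = "smooth_generated U", OF U F])
  fix F :: "'a \<Rightarrow> real" and x assume "smooth_generated U F" "x \<in> U"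
  then show "F differentiable at x"
    using smooth_generated_derivative [OF U] by (meson differentiable_def)
next
  fix F :: "'a \<Rightarrow> real" and v assume "smooth_generated U F"
  then obtain F' where F': "\<forall>x\<in>U. (F has_derivative F' x) (at x)"
      "\<forall>v. smooth_generated U (\<lambda>x. F' x v)"
    using smooth_generated_derivative [OF U] by blast
  then show "\<exists>G. smooth_generated U G \<and> (\<forall>x\<in>U. frechet_derivative F (at x) v = G x)"
    using frechet_derivative_at by metis
qed

lemma smooth_on_mult:
  fixes F G :: "'a::euclidean_space \<Rightarrow> real"
  shows "open U \<Longrightarrow> smooth_on U F \<Longrightarrow> smooth_on U G \<Longrightarrow> smooth_on U (\<lambda>x. F x * G x)"
  by (simp add: smooth_generated_imp_smooth_on smooth_generated.intros)

lemma smooth_on_inverse: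
  fixes F :: "'a::euclidean_space \<Rightarrow> real"
  shows "open U \<Longrightarrow> smooth_on U F \<Longrightarrow> (\<And>x. x \<in> U \<Longrightarrow> F x \<noteq> 0) \<Longrightarrow> smooth_on U (\<lambda>x. inverse (F x))"
  by (simp add: smooth_generated_imp_smooth_on smooth_generated.intros)

lemma smooth_on_diff:
  fixes F G :: "'a::euclidean_space \<Rightarrow> real"
  assumes "open U" "smooth_on U F" "smooth_on U G"
  shows "smooth_on U (\<lambda>x. F x - G x)"
  using smooth_on_add [OF assms(1,2) smooth_on_mult [OF assms(1) smooth_on_const [OF assms(1)] assms(3)],
      of "-1"] by simp

lemma smooth_on_divide:
  fixes F G :: "'a::euclidean_space \<Rightarrow> real"
  shows "open U \<Longrightarrow> smooth_on U F \<Longrightarrow> smooth_on U G \<Longrightarrow> (\<And>x. x \<in> U \<Longrightarrow> G x \<noteq> 0) \<Longrightarrow>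
    smooth_on U (\<lambda>x. F x / G x)"
  unfolding divide_inverse by (intro smooth_on_mult smooth_on_inverse)

lemma smooth_on_power:
  fixes F :: "'a::euclidean_space \<Rightarrow> real"
  shows "open U \<Longrightarrow> smooth_on U F \<Longrightarrow> smooth_on U (\<lambda>x. F x ^ n)"
  by (induction n) (auto intro: smooth_on_const smooth_on_mult)

lemmas smooth_on_intros = smooth_on_const smooth_on_add smooth_on_diff smooth_on_mult
  smooth_on_divide smooth_on_power

lemma smooth_onI_real_derivative:
  fixes h :: "real \<Rightarrow> real"
  assumes "open J" and "\<And>r. r \<in> J \<Longrightarrow> (h has_real_derivative h' r) (at r)" and "smooth_on J h'"
  shows "smooth_on J h"
  by (rule smooth_onI_has_derivative [where F' = "\<lambda>r. (*) (h' r)"])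
     (use assms in \<open>auto simp: has_field_derivative_def intro: smooth_on_intros\<close>)

lemma smooth_on_DERIV:
  fixes h :: "real \<Rightarrow> real"
  assumes "smooth_on J h" and "r \<in> J"
  shows "(h has_real_derivative deriv h r) (at r)"
  using smooth_on_differentiable [OF assms]
  by (metis DERIV_imp_deriv real_differentiableE)

lemma smooth_on_deriv:
  fixes h :: "real \<Rightarrow> real"
  assumes "open J" and "smooth_on J h"
  shows "smooth_on J (deriv h)"
proof (rule smooth_on_cong [OF assms(1) smooth_on_frechet_derivative [OF assms(2), of 1]])
  fix r assume "r \<in> J"
  then have "(h has_derivative (*) (deriv h r)) (at r)"
    using smooth_on_DERIV [OF assms(2)] by (simp add: has_field_derivative_def)
  then show "frechet_derivative h (at r) 1 = deriv h r"
    by (metis frechet_derivative_at mult.right_neutral)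
qed

lemma smooth_on_DERIV_deriv:
  fixes h :: "real \<Rightarrow> real"
  assumes "open J" and "smooth_on J h" and "r \<in> J"
  shows "(deriv h has_real_derivative deriv (deriv h) r) (at r)"
  by (rule smooth_on_DERIV [OF smooth_on_deriv [OF assms(1,2)] assms(3)])

text \<open>
  Derivatives of the sine stay in the span of sine and cosine, which serves as the coinduction
  invariant.
\<close>

lemma smooth_on_sin: "open J \<Longrightarrow> smooth_on J (sin :: real \<Rightarrow> real)"
proof (rule smooth_on_coinduct [where P = "\<lambda>F. \<exists>a b. F = (\<lambda>r. a * sin r + b * cos r)"])
  have *: "((\<lambda>r. a * sin r + b * cos r) has_derivative (\<lambda>v. (a * cos r - b * sin r) * v)) (at r)"
    for a b r :: real
    unfolding has_field_derivative_def [symmetric]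
    by (auto intro!: derivative_eq_intros)
  show "F differentiable at r" if "\<exists>a b. F = (\<lambda>r. a * sin r + b * cos r)" for F :: "real \<Rightarrow> real" and r
    using that * by (auto simp: differentiable_def)
  show "\<exists>G. (\<exists>a b. G = (\<lambda>r. a * sin r + b * cos r)) \<and> (\<forall>r\<in>J. frechet_derivative F (at r) v = G r)"
    if "\<exists>a b. F = (\<lambda>r. a * sin r + b * cos r)" for F :: "real \<Rightarrow> real" and v
  proof -
    from that obtain a b where F: "F = (\<lambda>r. a * sin r + b * cos r)" by blast
    have "frechet_derivative F (at r) v = (- b * v) * sin r + (a * v) * cos r" for r
      unfolding F frechet_derivative_at [OF *, symmetric] by (simp add: algebra_simps)
    then show ?thesis by blast
  qed
  show "\<exists>a b. sin = (\<lambda>r. a * sin r + b * cos r)" by (intro exI [of _ 1] exI [of _ 0]) simp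
qed

text \<open>
  For linear \<^term>\<open>p\<close> the derivative of \<open>h \<circ> p\<close> in a fixed direction is again of the form
  \<open>h' \<circ> p\<close> with smooth \<open>h'\<close>, since the inner derivative is constant. This transfers
  smoothness from one-variable profiles to radial fields on a chart.
\<close>

lemma smooth_on_compose_linear:
  fixes h :: "real \<Rightarrow> real" and c :: "'b::real_normed_vector"
  assumes U: "open U" and p: "bounded_linear p" and pU: "p ` U \<subseteq> J" and h: "smooth_on J h"
  shows "smooth_on U (\<lambda>x. h (p x) *\<^sub>R c)"
proof (rule smooth_on_coinduct [where P = "\<lambda>F. \<exists>h. smooth_on J h \<and> F = (\<lambda>x. h (p x) *\<^sub>R c)", OF U])
  show "\<exists>g. smooth_on J g \<and> (\<lambda>x. h (p x) *\<^sub>R c) = (\<lambda>x. g (p x) *\<^sub>R c)" using h by blast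
next
  have *: "((\<lambda>x. h (p x) *\<^sub>R c) has_derivative (\<lambda>v. frechet_derivative h (at (p x)) (p v) *\<^sub>R c)) (at x)"
    if "smooth_on J h" "x \<in> U" for h x
  proof -
    have "(h has_derivative frechet_derivative h (at (p x))) (at (p x))"
      using that pU smooth_on_differentiable [of J h "p x"] by (auto simp flip: frechet_derivative_works)
    then have "((\<lambda>x. h (p x)) has_derivative (\<lambda>v. frechet_derivative h (at (p x)) (p v))) (at x)"
      using has_derivative_compose [OF bounded_linear_imp_has_derivative [OF p]] by blast
    then show ?thesis by (rule has_derivative_scaleR_left)
  qed
  show "F differentiable at x" if "\<exists>h. smooth_on J h \<and> F = (\<lambda>x. h (p x) *\<^sub>R c)" "x \<in> U" for F x
    using that * by (auto simp: differentiable_def)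
  show "\<exists>G. (\<exists>h. smooth_on J h \<and> G = (\<lambda>x. h (p x) *\<^sub>R c)) \<and>
      (\<forall>x\<in>U. frechet_derivative F (at x) v = G x)"
    if "\<exists>h. smooth_on J h \<and> F = (\<lambda>x. h (p x) *\<^sub>R c)" for F v
  proof -
    from that obtain h where h: "smooth_on J h" "F = (\<lambda>x. h (p x) *\<^sub>R c)" by blast
    have "frechet_derivative F (at x) v = frechet_derivative h (at (p x)) (p v) *\<^sub>R c" if "x \<in> U" for x
      unfolding h using frechet_derivative_at [OF * [OF h(1) that]] by metis
    then show ?thesis using smooth_on_frechet_derivative [OF h(1), of "p v"]
      by (intro exI [of _ "\<lambda>x. frechet_derivative h (at (p x)) (p v) *\<^sub>R c"]) auto
  qed
qed

section \<open>The radial Laplacian of the sphere\<close>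

text \<open>
  The isothermal coordinate of the Mercator projection, in which the metric of the sphere is
  \<open>sin\<^sup>2 r (dt\<^sup>2 + d\<theta>\<^sup>2)\<close>.
\<close>

definition mercator :: "real \<Rightarrow> real" where
  "mercator r = ln (tan (r / 2))"

text \<open>
  The Laplacian of the sphere on functions of the polar distance.
\<close>

definition radial_laplacian :: "(real \<Rightarrow> real) \<Rightarrow> real \<Rightarrow> real" where
  "radial_laplacian w r = deriv (deriv w) r + cos r / sin r * deriv w r"

lemma sin_pos_on: "r \<in> {0<..<pi} \<Longrightarrow> 0 < sin r"
  by (auto intro: sin_gt_zero)

lemma DERIV_mercator:
  assumes "r \<in> {0<..<pi}"
  shows "(mercator has_real_derivative 1 / sin r) (at r)"
proof -
  have s: "0 < sin (r/2)" and c: "0 < cos (r/2)"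
    using assms by (auto intro: sin_gt_zero cos_gt_zero)
  have "sin r = 2 * sin (r/2) * cos (r/2)"
    using sin_double [of "r/2"] by simp
  then show ?thesis
    unfolding mercator_def using s c
    by (auto intro!: derivative_eq_intros simp: tan_def field_simps power2_eq_square)
qed

lemma smooth_on_mercator: "smooth_on {0<..<pi} mercator"
  by (rule smooth_onI_real_derivative [OF _ DERIV_mercator])
     (auto intro!: smooth_on_intros smooth_on_sin dest: sin_pos_on)

lemma radial_laplacian_cong:
  assumes "\<And>r. r \<in> {0<..<pi} \<Longrightarrow> v r = w r" and r: "r \<in> {0<..<pi}"
  shows "radial_laplacian v r = radial_laplacian w r"
proof -
  have "\<forall>\<^sub>F s in nhds r. v s = w s" if "r \<in> {0<..<pi}" for r
    using eventually_nhds_in_open [OF open_greaterThanLessThan that] assms(1)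
    by (auto elim: eventually_mono)
  then have d: "deriv v r = deriv w r" if "r \<in> {0<..<pi}" for r
    using that by (intro deriv_cong_ev) auto
  have "\<forall>\<^sub>F s in nhds r. deriv v s = deriv w s"
    using eventually_nhds_in_open [OF open_greaterThanLessThan r] d
    by (auto elim: eventually_mono)
  then have "deriv (deriv v) r = deriv (deriv w) r" by (intro deriv_cong_ev) auto
  then show ?thesis using d [OF r] by (simp add: radial_laplacian_def)
qed

lemma radial_laplacian_eqI:
  assumes w: "\<And>r. r \<in> {0<..<pi} \<Longrightarrow> (w has_real_derivative w' r) (at r)"
    and r: "r \<in> {0<..<pi}" and w': "(w' has_real_derivative w'') (at r)"
  shows "radial_laplacian w r = w'' + cos r / sin r * w' r"
proof -
  have d: "deriv w s = w' s" if "s \<in> {0<..<pi}" for s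
    using w [OF that] by (rule DERIV_imp_deriv)
  have "(deriv w has_real_derivative w'') (at r)"
    by (rule has_field_derivative_transform_within_open [OF w' open_greaterThanLessThan r]) (simp add: d)
  then show ?thesis
    using d [OF r] by (simp add: radial_laplacian_def DERIV_imp_deriv)
qed

text \<open>
  The Laplacian is conformally covariant in dimension two, and the conformal factor of the
  coordinate \<^const>\<open>mercator\<close> is \<open>sin\<^sup>2 r\<close>.
\<close>

lemma radial_laplacian_compose_mercator:
  assumes "\<And>t. (q has_real_derivative q' t) (at t)"
    and "\<And>t. (q' has_real_derivative q'' t) (at t)" and r: "r \<in> {0<..<pi}"
  shows "radial_laplacian (\<lambda>r. q (mercator r)) r = q'' (mercator r) / (sin r)\<^sup>2"
proof -
  have "radial_laplacian (\<lambda>r. q (mercator r)) r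
      = (q'' (mercator r) - q' (mercator r) * cos r) / (sin r)\<^sup>2
        + cos r / sin r * (q' (mercator r) / sin r)"
  proof (rule radial_laplacian_eqI)
    show "((\<lambda>r. q (mercator r)) has_real_derivative q' (mercator r) / sin r) (at r)"
      if "r \<in> {0<..<pi}" for r
      using DERIV_chain2 [OF assms(1) DERIV_mercator [OF that]] by simp
    have *: "((\<lambda>r. q' (mercator r)) has_real_derivative q'' (mercator r) * (1 / sin r)) (at r)"
      by (rule DERIV_chain2 [OF assms(2) DERIV_mercator [OF r]])
    show "((\<lambda>r. q' (mercator r) / sin r) has_real_derivative
        (q'' (mercator r) - q' (mercator r) * cos r) / (sin r)\<^sup>2) (at r)"
      using sin_pos_on [OF r]
      by (auto intro!: derivative_eq_intros * simp: field_simps power2_eq_square)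
  qed (use r in auto)
  then show ?thesis
    using sin_pos_on [OF r] by (simp add: field_simps power2_eq_square)
qed

lemma radial_laplacian_diff:
  assumes v: "smooth_on {0<..<pi} v" and w: "smooth_on {0<..<pi} w" and r: "r \<in> {0<..<pi}"
  shows "radial_laplacian (\<lambda>r. v r - w r) r = radial_laplacian v r - radial_laplacian w r"
proof -
  have o: "open {0<..<pi}" by simp
  note d = smooth_on_DERIV [OF v] smooth_on_DERIV [OF w]
    smooth_on_DERIV_deriv [OF o v] smooth_on_DERIV_deriv [OF o w]
  have "radial_laplacian (\<lambda>r. v r - w r) r
      = deriv (deriv v) r - deriv (deriv w) r + cos r / sin r * (deriv v r - deriv w r)"
    by (rule radial_laplacian_eqI) (auto intro!: derivative_eq_intros d simp: r r [simplified])
  then show ?thesis by (simp add: radial_laplacian_def algebra_simps)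
qed

lemma radial_laplacian_mult:
  assumes v: "smooth_on {0<..<pi} v" and w: "smooth_on {0<..<pi} w" and r: "r \<in> {0<..<pi}"
  shows "radial_laplacian (\<lambda>r. v r * w r) r
    = v r * radial_laplacian w r + radial_laplacian v r * w r + 2 * deriv v r * deriv w r"
proof -
  have o: "open {0<..<pi}" by simp
  note d = smooth_on_DERIV [OF v] smooth_on_DERIV [OF w]
    smooth_on_DERIV_deriv [OF o v] smooth_on_DERIV_deriv [OF o w]
  have "radial_laplacian (\<lambda>r. v r * w r) r
      = (deriv (deriv v) r * w r + deriv v r * deriv w r + (deriv v r * deriv w r + v r * deriv (deriv w) r))
        + cos r / sin r * (deriv v r * w r + v r * deriv w r)"
    by (rule radial_laplacian_eqI) (auto intro!: derivative_eq_intros d simp: r r [simplified])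
  then show ?thesis by (simp add: radial_laplacian_def algebra_simps)
qed

text \<open>
  The equation \<open>L w = 0\<close> says \<open>(sin r w')' = 0\<close>, so \<open>w' = b / sin r\<close>, which is \<open>b\<close> times
  the derivative of \<^const>\<open>mercator\<close>.
\<close>

lemma radial_laplacian_eq_0_iff:
  assumes w: "smooth_on {0<..<pi} w"
  shows "(\<forall>r\<in>{0<..<pi}. radial_laplacian w r = 0) \<longleftrightarrow>
    (\<exists>a b. \<forall>r\<in>{0<..<pi}. w r = a + b * mercator r)"
proof
  assume L: "\<forall>r\<in>{0<..<pi}. radial_laplacian w r = 0"
  have o: "open {0<..<pi}" by simp
  note w1 = smooth_on_DERIV [OF w] and w2 = smooth_on_DERIV_deriv [OF o w]
  have "((\<lambda>r. sin r * deriv w r) has_real_derivative 0) (at r)" if r: "r \<in> {0<..<pi}" for r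
  proof -
    have "sin r * deriv (deriv w) r + cos r * deriv w r = 0"
      using bspec [OF L r] sin_pos_on [OF r] by (simp add: radial_laplacian_def field_simps)
    then show ?thesis
      by (auto intro!: derivative_eq_intros w2 r simp: algebra_simps)
  qed
  then have "((\<lambda>r. sin r * deriv w r) has_real_derivative 0) (at r within {0<..<pi})"
    if "r \<in> {0<..<pi}" for r using that has_field_derivative_at_within by blast
  from has_field_derivative_zero_constant [OF _ this]
  obtain b where b: "sin r * deriv w r = b" if "r \<in> {0<..<pi}" for r by auto
  have "((\<lambda>r. w r - b * mercator r) has_real_derivative 0) (at r within {0<..<pi})"
    if r: "r \<in> {0<..<pi}" for r
  proof -
    have "deriv w r - b * (1 / sin r) = 0" using b [OF r] sin_pos_on [OF r] by (auto simp: field_simps)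
    moreover have "((\<lambda>r. w r - b * mercator r) has_real_derivative deriv w r - b * (1 / sin r)) (at r)"
      by (intro DERIV_diff w1 DERIV_cmult DERIV_mercator r)
    ultimately show ?thesis using has_field_derivative_at_within by metis
  qed
  from has_field_derivative_zero_constant [OF _ this]
  obtain a where "w r - b * mercator r = a" if "r \<in> {0<..<pi}" for r by auto
  then have "\<forall>r\<in>{0<..<pi}. w r = a + b * mercator r" by (simp add: algebra_simps)
  then show "\<exists>a b. \<forall>r\<in>{0<..<pi}. w r = a + b * mercator r" by blast
next
  assume "\<exists>a b. \<forall>r\<in>{0<..<pi}. w r = a + b * mercator r"
  then obtain a b where ab: "\<And>r. r \<in> {0<..<pi} \<Longrightarrow> w r = a + b * mercator r" by blast
  show "\<forall>r\<in>{0<..<pi}. radial_laplacian w r = 0"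
  proof
    fix r assume r: "r \<in> {0<..<pi}"
    have "radial_laplacian w r = radial_laplacian (\<lambda>r. a + b * mercator r) r"
      by (rule radial_laplacian_cong [OF ab r])
    also have "\<dots> = 0 / (sin r)\<^sup>2"
      by (rule radial_laplacian_compose_mercator [where q = "\<lambda>t. a + b * t" and q' = "\<lambda>t. b" and q'' = "\<lambda>t. 0"])
         (use r in \<open>auto intro!: derivative_eq_intros\<close>)
    finally show "radial_laplacian w r = 0" by simp
  qed
qed

lemma smooth_on_radial_laplacian:
  assumes "smooth_on {0<..<pi} w"
  shows "smooth_on {0<..<pi} (radial_laplacian w)"
proof -
  have "smooth_on {0<..<pi} (deriv sin)" by (intro smooth_on_deriv smooth_on_sin) auto
  also have "deriv sin = (cos :: real \<Rightarrow> real)" by (intro ext DERIV_imp_deriv DERIV_sin)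
  finally have cos: "smooth_on {0<..<pi} (cos :: real \<Rightarrow> real)" .
  show ?thesis
    unfolding radial_laplacian_def
    by (intro smooth_on_intros smooth_on_deriv assms cos smooth_on_sin) (use sin_pos_on in force)+
qed

text \<open>
  The second antiderivative of \<open>k\<^sup>2 / 2 + (a + b t) (1 + t\<^sup>2)\<^sup>2\<close> that vanishes to second order
  at \<open>t = 0\<close>.
\<close>

definition profile :: "real \<Rightarrow> real \<Rightarrow> real \<Rightarrow> real \<Rightarrow> real" where
  "profile k a b t = (a / 2 + k\<^sup>2 / 4) * t ^ 2 + b / 6 * t ^ 3 + a / 6 * t ^ 4 + b / 10 * t ^ 5
     + a / 30 * t ^ 6 + b / 42 * t ^ 7"

lemma radial_laplacian_profile:
  assumes "r \<in> {0<..<pi}"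
  shows "radial_laplacian (\<lambda>r. profile k a b (mercator r)) r
    = (k\<^sup>2 / 2 + (a + b * mercator r) * (1 + (mercator r)\<^sup>2)\<^sup>2) / (sin r)\<^sup>2"
proof (rule radial_laplacian_compose_mercator [OF _ _ assms])
  show "(profile k a b has_real_derivative
      (a + k\<^sup>2 / 2) * t + b / 2 * t ^ 2 + 2 * a / 3 * t ^ 3 + b / 2 * t ^ 4 + a / 5 * t ^ 5 + b / 6 * t ^ 6) (at t)" for t
    unfolding profile_def [abs_def]
    by (auto intro!: derivative_eq_intros simp: field_simps)
  show "((\<lambda>t. (a + k\<^sup>2 / 2) * t + b / 2 * t ^ 2 + 2 * a / 3 * t ^ 3 + b / 2 * t ^ 4 + a / 5 * t ^ 5 + b / 6 * t ^ 6)
      has_real_derivative k\<^sup>2 / 2 + (a + b * t) * (1 + t\<^sup>2)\<^sup>2) (at t)" for t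
    by (auto intro!: derivative_eq_intros simp: field_simps power2_eq_square power3_eq_cube)
       (simp add: algebra_simps eval_nat_numeral)
qed

lemma smooth_on_profile: "smooth_on {0<..<pi} (\<lambda>r. profile k a b (mercator r))"
  unfolding profile_def
  by (intro smooth_on_add smooth_on_mult smooth_on_power smooth_on_const smooth_on_mercator) auto

text \<open>
  The radial component of the tension field of a rotational map; see \<open>tension_rotational\<close>.
\<close>

definition tension_profile :: "(real \<Rightarrow> real) \<Rightarrow> real \<Rightarrow> real \<Rightarrow> real" where
  "tension_profile \<rho> k r = radial_laplacian \<rho> r - k\<^sup>2 / (2 * (sin r)\<^sup>2)"

lemma smooth_on_tension_profile:
  assumes "smooth_on {0<..<pi} \<rho>"
  shows "smooth_on {0<..<pi} (tension_profile \<rho> k)"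
  unfolding tension_profile_def
  by (intro smooth_on_intros smooth_on_radial_laplacian assms smooth_on_sin) (use sin_pos_on in force)+

text \<open>
  The kernel of \<^const>\<open>radial_laplacian\<close> is used twice. It first gives \<open>f X = a + b t\<close>; after
  multiplication by \<open>(1 + t\<^sup>2)\<^sup>2\<close> this states that \<open>\<rho>\<close> and the polynomial
  \<^const>\<open>profile\<close> have the same radial Laplacian, so their difference lies in the kernel as well.
\<close>

lemma weighted_tension_harmonic_iff:
  assumes f: "\<And>r. r \<in> {0<..<pi} \<Longrightarrow> f r = (sin r)\<^sup>2 / (1 + (mercator r)\<^sup>2)\<^sup>2"
    and smooth: "smooth_on {0<..<pi} f" "smooth_on {0<..<pi} \<rho>"
  shows "(\<forall>r\<in>{0<..<pi}. radial_laplacian (\<lambda>r. f r * tension_profile \<rho> k r) r = 0) \<longleftrightarrow>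
    (\<exists>a b c d. \<forall>r\<in>{0<..<pi}. \<rho> r = d + c * mercator r + profile k a b (mercator r))"
proof -
  have *: "f r * tension_profile \<rho> k r = a + b * mercator r \<longleftrightarrow>
      radial_laplacian (\<lambda>r. \<rho> r - profile k a b (mercator r)) r = 0" if r: "r \<in> {0<..<pi}" for r a b
  proof -
    define p where "p = (1 + (mercator r)\<^sup>2)\<^sup>2"
    have p: "p > 0" unfolding p_def by (intro zero_less_power add_pos_nonneg) auto
    have s: "sin r > 0" by (rule sin_pos_on [OF r])
    have "(sin r)\<^sup>2 * radial_laplacian (\<lambda>r. \<rho> r - profile k a b (mercator r)) r
        = (sin r)\<^sup>2 * radial_laplacian \<rho> r - k\<^sup>2 / 2 - (a + b * mercator r) * p"
      using s by (simp add: radial_laplacian_diff [OF smooth(2) smooth_on_profile r]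
          radial_laplacian_profile [OF r] p_def right_diff_distrib)
    moreover have "p * (f r * tension_profile \<rho> k r) = (sin r)\<^sup>2 * radial_laplacian \<rho> r - k\<^sup>2 / 2"
      using s p by (simp add: f [OF r] tension_profile_def right_diff_distrib flip: p_def)
    ultimately have "(sin r)\<^sup>2 * radial_laplacian (\<lambda>r. \<rho> r - profile k a b (mercator r)) r
        = p * (f r * tension_profile \<rho> k r - (a + b * mercator r))"
      by (simp add: algebra_simps)
    then have "p * (f r * tension_profile \<rho> k r - (a + b * mercator r)) = 0 \<longleftrightarrow>
        (sin r)\<^sup>2 * radial_laplacian (\<lambda>r. \<rho> r - profile k a b (mercator r)) r = 0" by (simp only:)
    then show ?thesis
      using p s unfolding mult_eq_0_iff power_eq_0_iff eq_iff_diff_eq_0 [of "_ * _"] by simp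
  qed
  have "(\<forall>r\<in>{0<..<pi}. radial_laplacian (\<lambda>r. f r * tension_profile \<rho> k r) r = 0) \<longleftrightarrow>
      (\<exists>a b. \<forall>r\<in>{0<..<pi}. f r * tension_profile \<rho> k r = a + b * mercator r)"
    by (intro radial_laplacian_eq_0_iff smooth_on_mult smooth_on_tension_profile smooth) simp
  also have "\<dots> \<longleftrightarrow> (\<exists>a b. \<forall>r\<in>{0<..<pi}. radial_laplacian (\<lambda>r. \<rho> r - profile k a b (mercator r)) r = 0)"
    by (simp only: * cong: ball_cong)
  also have "\<dots> \<longleftrightarrow> (\<exists>a b d c. \<forall>r\<in>{0<..<pi}. \<rho> r - profile k a b (mercator r) = d + c * mercator r)"
    by (intro arg_cong [where f = Ex] ext radial_laplacian_eq_0_iff smooth_on_diff smooth_on_profile smooth) simp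
  also have "\<dots> \<longleftrightarrow> (\<exists>a b c d. \<forall>r\<in>{0<..<pi}. \<rho> r = d + c * mercator r + profile k a b (mercator r))"
    by (subst (3) ex_comm) (simp add: algebra_simps)
  finally show ?thesis .
qed

section \<open>Warped product metrics in dimension two\<close>

text \<open>
  Both surfaces have metrics \<open>ds\<^sup>2 + w(s) d\<theta>\<^sup>2\<close>, so that their Christoffel symbols can be
  computed together. The function \<^term>\<open>w\<close> is the coefficient itself, the square of the
  customary warping function.
\<close>

definition warped_metric :: "(real \<Rightarrow> real) \<Rightarrow> 2 metric" where
  "warped_metric w x = vector [vector [1, 0], vector [0, w (x $ 1)]]"

lemma sphere_metric_warped: "sphere_metric = warped_metric (\<lambda>r. (sin r)\<^sup>2)"
  by (simp add: fun_eq_iff sphere_metric_def warped_metric_def)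

lemma target_metric_warped: "target_metric = warped_metric (\<lambda>s. s)"
  by (simp add: fun_eq_iff target_metric_def warped_metric_def)

lemma vector2_eq: "(vector [a, b] :: real^2) = a *\<^sub>R axis 1 1 + b *\<^sub>R axis 2 1"
  by (simp add: vec_eq_iff forall_2 vector_2 axis_def)

lemma matrix_inv_unique:
  fixes A B :: "'a::semiring_1^'n^'n"
  assumes "A ** B = mat 1" "B ** A = mat 1"
  shows "matrix_inv A = B"
proof -
  have "matrix_inv A ** A = mat 1"
    unfolding matrix_inv_def using someI_ex [of "\<lambda>C. A ** C = mat 1 \<and> C ** A = mat 1"] assms by blast
  then have "matrix_inv A = (matrix_inv A ** A) ** B"
    using assms(1) by (metis matrix_mul_assoc matrix_mul_rid)
  then show ?thesis
    using \<open>matrix_inv A ** A = mat 1\<close> by simp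
qed

lemma matrix_inv_warped:
  assumes "w (x $ 1) \<noteq> 0"
  shows "matrix_inv (warped_metric w x) = vector [vector [1, 0], vector [0, 1 / w (x $ 1)]]"
  by (rule matrix_inv_unique)
     (use assms in \<open>simp_all add: vec_eq_iff forall_2 warped_metric_def matrix_matrix_mult_def sum_2 vector_2 mat_def\<close>)

lemma metric_trace_warped:
  assumes "w (x $ 1) \<noteq> 0"
  shows "metric_trace (warped_metric w) x B
    = B (axis 1 1) (axis 1 1) + (1 / w (x $ 1)) *\<^sub>R B (axis 2 1) (axis 2 1)"
  by (simp add: metric_trace_def matrix_inv_warped [of w x, OF assms] sum_2 vector_2)

lemma has_derivative_first_coordinate:
  fixes x :: "real^2"
  assumes "(a has_real_derivative a') (at (x $ 1))"
  shows "((\<lambda>y. a (y $ 1)) has_derivative (\<lambda>v. a' * v $ 1)) (at x)"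
  by (rule has_derivative_compose [OF bounded_linear_imp_has_derivative [OF bounded_linear_vec_nth]
        assms [unfolded has_field_derivative_def]])

lemma has_derivative_vector2:
  assumes "(A has_derivative A') (at x)" "(B has_derivative B') (at x)"
  shows "((\<lambda>y. vector [A y, B y] :: real^2) has_derivative (\<lambda>v. vector [A' v, B' v])) (at x)"
  unfolding vector2_eq by (intro has_derivative_add has_derivative_scaleR_left assms)

lemma has_derivative_radial_field:
  fixes x :: "real^2"
  assumes "(a has_real_derivative a') (at (x $ 1))" "(b has_real_derivative b') (at (x $ 1))"
  shows "((\<lambda>y. vector [a (y $ 1), b (y $ 1)] :: real^2) has_derivative
    (\<lambda>v. vector [a' * v $ 1, b' * v $ 1])) (at x)"
  by (intro has_derivative_vector2 has_derivative_first_coordinate assms)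

lemma partial_warped:
  assumes w: "(w has_real_derivative d) (at (x $ 1))"
  shows "partial i (\<lambda>y. warped_metric w y $ j $ l) x = (if i = 1 \<and> j = 2 \<and> l = 2 then d else 0)"
proof (cases "j = 2 \<and> l = 2")
  case True
  then show ?thesis
    using frechet_derivative_at [OF has_derivative_first_coordinate [OF w], symmetric]
    by (auto simp: partial_def warped_metric_def vector_2 axis_def)
next
  case False
  then have "(\<lambda>y. warped_metric w y $ j $ l) = (\<lambda>y. if j = 1 \<and> l = 1 then 1 else 0)"
    using exhaust_2 [of j] exhaust_2 [of l] by (auto simp: warped_metric_def vector_2)
  then show ?thesis using False by (auto simp: partial_def frechet_derivative_const)
qed

text \<open>
  The only nonzero Christoffel symbols are \<open>\<Gamma>\<^sup>1\<^sub>2\<^sub>2 = - w' / 2\<close> and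
  \<open>\<Gamma>\<^sup>2\<^sub>1\<^sub>2 = \<Gamma>\<^sup>2\<^sub>2\<^sub>1 = w' / (2 w)\<close>.
\<close>

lemma connection_form_warped:
  assumes w: "(w has_real_derivative d) (at (x $ 1))" and "w (x $ 1) \<noteq> 0"
  shows "connection_form (warped_metric w) x u v
    = vector [- d / 2 * u $ 2 * v $ 2, d / (2 * w (x $ 1)) * (u $ 1 * v $ 2 + u $ 2 * v $ 1)]"
  using assms(2)
  by (simp add: connection_form_def christoffel_def partial_warped [OF w] matrix_inv_warped
      vec_eq_iff forall_2 sum_2 vector_2 field_simps)

lemma gradient_warped:
  assumes "w (x $ 1) \<noteq> 0" and f: "(f has_real_derivative d) (at (x $ 1))"
  shows "gradient (warped_metric w) (\<lambda>y. f (y $ 1)) x = vector [d, 0]"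
  using frechet_derivative_at [OF has_derivative_first_coordinate [OF f], symmetric]
  by (simp add: gradient_def partial_def matrix_inv_warped [of w x, OF assms(1)]
      vec_eq_iff forall_2 sum_2 vector_2 axis_def)

lemma riemannian_chart_warped:
  assumes U: "open U" "U \<noteq> {}" and w: "smooth_on J w"
    and J: "\<And>x. x \<in> U \<Longrightarrow> x $ 1 \<in> J" "\<And>s. s \<in> J \<Longrightarrow> 0 < w s"
  shows "riemannian_chart U (warped_metric w)"
proof -
  have "smooth_on U (\<lambda>x. vector [vector [1, 0], vector [0, 0]] + w (x $ 1) *\<^sub>R (vector [vector [0, 0], vector [0, 1]] :: real^2^2))"
    using J U(1) w
    by (intro smooth_on_add smooth_on_const smooth_on_compose_linear [where J = J] bounded_linear_vec_nth) auto
  also have "(\<lambda>x. vector [vector [1, 0], vector [0, 0]] + w (x $ 1) *\<^sub>R (vector [vector [0, 0], vector [0, 1]] :: real^2^2))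
      = warped_metric w"
    by (simp add: fun_eq_iff warped_metric_def vec_eq_iff forall_2 vector_2)
  finally have "smooth_on U (warped_metric w)" .
  moreover have "transpose (warped_metric w x) = warped_metric w x" for x
    by (simp add: warped_metric_def vec_eq_iff forall_2 vector_2 transpose_def)
  moreover have "v \<bullet> (warped_metric w x *v v) > 0" if x: "x \<in> U" and v: "v \<noteq> 0" for x v
  proof -
    have eq: "v \<bullet> (warped_metric w x *v v) = (v $ 1)\<^sup>2 + w (x $ 1) * (v $ 2)\<^sup>2"
      by (simp add: warped_metric_def inner_vec_def matrix_vector_mult_def sum_2 vector_2
          power2_eq_square algebra_simps)
    have "v $ 1 \<noteq> 0 \<or> v $ 2 \<noteq> 0" using v by (auto simp: vec_eq_iff forall_2)
    moreover have "0 < w (x $ 1)" using J x by blast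
    ultimately show ?thesis unfolding eq
      by (auto intro: add_pos_nonneg add_nonneg_pos)
  qed
  ultimately show ?thesis using U by (auto simp: riemannian_chart_def)
qed

section \<open>The sphere chart and the target surface\<close>

lemma open_sphere_chart:
  assumes "open I"
  shows "open (sphere_chart I)"
proof -
  have "sphere_chart I = (\<lambda>x. x $ 1) -` {0<..<pi} \<inter> (\<lambda>x. x $ 2) -` I"
    by (auto simp: sphere_chart_def)
  then show ?thesis
    using assms by (auto intro!: open_Int open_vimage continuous_intros)
qed

lemma sphere_chart_D: "x \<in> sphere_chart I \<Longrightarrow> x $ 1 \<in> {0<..<pi}"
  by (simp add: sphere_chart_def)

lemma sphere_chart_all_iff:
  assumes "I \<noteq> {}"
  shows "(\<forall>x\<in>sphere_chart I. P (x $ 1)) \<longleftrightarrow> (\<forall>r\<in>{0<..<pi}. P r)"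
proof
  assume P: "\<forall>x\<in>sphere_chart I. P (x $ 1)"
  obtain \<theta> where "\<theta> \<in> I" using assms by blast
  then have "vector [r, \<theta>] \<in> sphere_chart I" if "r \<in> {0<..<pi}" for r
    using that by (simp add: sphere_chart_def vector_2)
  then show "\<forall>r\<in>{0<..<pi}. P r" using P by (metis vector_2(1))
qed (auto dest: sphere_chart_D)

lemma sphere_trace:
  assumes "x \<in> sphere_chart I"
  shows "metric_trace sphere_metric x B
    = B (axis 1 1) (axis 1 1) + (1 / (sin (x $ 1))\<^sup>2) *\<^sub>R B (axis 2 1) (axis 2 1)"
  using sin_pos_on [OF sphere_chart_D [OF assms]] unfolding sphere_metric_warped
  by (intro metric_trace_warped) simp

lemma sphere_covariant_const:
  assumes "x \<in> sphere_chart I"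
  shows "covariant sphere_metric u (\<lambda>_. v) x
    = vector [- sin (x $ 1) * cos (x $ 1) * u $ 2 * v $ 2,
        cos (x $ 1) / sin (x $ 1) * (u $ 1 * v $ 2 + u $ 2 * v $ 1)]"
proof -
  have s: "sin (x $ 1) > 0" by (rule sin_pos_on [OF sphere_chart_D [OF assms]])
  have "((\<lambda>r. (sin r)\<^sup>2) has_real_derivative 2 * sin (x $ 1) * cos (x $ 1)) (at (x $ 1))"
    by (auto intro!: derivative_eq_intros)
  from connection_form_warped [OF this, of u v] s show ?thesis
    by (simp add: covariant_def frechet_derivative_const sphere_metric_warped power2_eq_square)
qed

lemma target_connection_form:
  assumes "p $ 1 > 0"
  shows "connection_form target_metric p u v
    = vector [- (u $ 2 * v $ 2) / 2, (u $ 1 * v $ 2 + u $ 2 * v $ 1) / (2 * p $ 1)]"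
  using connection_form_warped [of "\<lambda>s. s" 1 p u v] assms
  by (simp add: target_metric_warped)

text \<open>
  On a surface the curvature tensor is determined by the Gauss curvature. Here the warping function
  is \<open>\<lambda> = \<surd>\<rho>\<close>, and the Gauss curvature \<open>- \<lambda>'' / \<lambda>\<close> is \<open>1 / (4 \<rho>\<^sup>2)\<close>.
\<close>

lemma target_curvature:
  assumes p: "p $ 1 > 0"
  shows "curvature target_metric p u v w
    = ((u $ 1 * v $ 2 - u $ 2 * v $ 1) / (4 * (p $ 1)\<^sup>2)) *\<^sub>R vector [p $ 1 * w $ 2, - w $ 1]"
proof -
  have c: "((\<lambda>y. covariant target_metric v (\<lambda>_. w) y) has_derivative
      (\<lambda>z. vector [0, - (v $ 1 * w $ 2 + v $ 2 * w $ 1) / (2 * (p $ 1)\<^sup>2) * z $ 1])) (at p)" for v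
  proof (rule has_derivative_transform_within_open)
    show "open {q :: real^2. q $ 1 > 0}"
      by (intro open_Collect_less continuous_intros)
    show "vector [- (v $ 2 * w $ 2) / 2, (v $ 1 * w $ 2 + v $ 2 * w $ 1) / (2 * q $ 1)]
        = covariant target_metric v (\<lambda>_. w) q" if "q \<in> {q. q $ 1 > 0}" for q
      using that by (simp add: covariant_def frechet_derivative_const target_connection_form)
    have "((\<lambda>q. vector [- (v $ 2 * w $ 2) / 2, (v $ 1 * w $ 2 + v $ 2 * w $ 1) / (2 * q $ 1)] :: real^2)
       has_derivative (\<lambda>z. vector [0 * z $ 1, - (v $ 1 * w $ 2 + v $ 2 * w $ 1) / (2 * (p $ 1)\<^sup>2) * z $ 1])) (at p)"
      using p by (intro has_derivative_radial_field)
        (auto intro!: derivative_eq_intros simp: field_simps power2_eq_square)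
    then show "((\<lambda>q. vector [- (v $ 2 * w $ 2) / 2, (v $ 1 * w $ 2 + v $ 2 * w $ 1) / (2 * q $ 1)] :: real^2)
       has_derivative (\<lambda>z. vector [0, - (v $ 1 * w $ 2 + v $ 2 * w $ 1) / (2 * (p $ 1)\<^sup>2) * z $ 1])) (at p)"
      by simp
  qed (use p in auto)
  \<comment> \<open>With constant components the bracket term drops out, leaving the two second derivatives.\<close>
  have "lie_bracket (\<lambda>_. u) (\<lambda>_. v) p = 0"
    by (simp add: lie_bracket_def frechet_derivative_const)
  then show ?thesis
    using p
    by (simp add: curvature_def curvature_field_def covariant_def [of _ _ "covariant _ _ _"]
        frechet_derivative_at [OF c, symmetric])
       (simp add: covariant_def frechet_derivative_const target_connection_form vec_eq_iff forall_2
        vector_2 field_simps power2_eq_square)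
qed

lemma sphere_laplacian_radial:
  assumes I: "open I" and f: "smooth_on {0<..<pi} f" and x: "x \<in> sphere_chart I"
  shows "laplacian sphere_metric (\<lambda>y. f (y $ 1)) x = radial_laplacian f (x $ 1)"
proof -
  have d: "frechet_derivative (\<lambda>y. f (y $ 1)) (at y) = (\<lambda>v. deriv f (y $ 1) * v $ 1)"
    if "y \<in> sphere_chart I" for y
    using frechet_derivative_at [OF has_derivative_first_coordinate [OF
        smooth_on_DERIV [OF f sphere_chart_D [OF that]]]] by simp
  have dd: "((\<lambda>y. frechet_derivative (\<lambda>y. f (y $ 1)) (at y) v) has_derivative
      (\<lambda>u. deriv (deriv f) (x $ 1) * u $ 1 * v $ 1)) (at x)" for v
  proof (rule has_derivative_transform_within_open [OF _ open_sphere_chart [OF I] x])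
    show "((\<lambda>y. deriv f (y $ 1) * v $ 1) has_derivative (\<lambda>u. deriv (deriv f) (x $ 1) * u $ 1 * v $ 1)) (at x)"
      by (intro has_derivative_mult_left has_derivative_first_coordinate
          smooth_on_DERIV_deriv [OF _ f sphere_chart_D [OF x]]) simp
  qed (simp add: d)
  show ?thesis
    using sin_pos_on [OF sphere_chart_D [OF x]]
    by (simp add: laplacian_def sphere_trace [OF x] sphere_covariant_const [OF x] d [OF x]
        frechet_derivative_at [OF dd, symmetric] radial_laplacian_def vector_2 axis_def
        field_simps power2_eq_square)
qed

section \<open>Tension and bitension of a rotational map\<close>

context
  fixes \<rho> :: "real \<Rightarrow> real" and k :: real and I :: "real set"
  assumes I: "open I" and smooth: "smooth_on {0<..<pi} \<rho>"
    and pos: "\<And>r. r \<in> {0<..<pi} \<Longrightarrow> 0 < \<rho> r"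
begin

lemma rotational_map_has_derivative:
  assumes "x \<in> sphere_chart I"
  shows "(rotational_map \<rho> k has_derivative (\<lambda>v. vector [deriv \<rho> (x $ 1) * v $ 1, k * v $ 2])) (at x)"
proof -
  have "((\<lambda>y. k * y $ 2) has_derivative (\<lambda>v. k * v $ 2)) (at x)" for x :: "real^2"
    by (intro has_derivative_mult_right bounded_linear_imp_has_derivative bounded_linear_vec_nth)
  then show ?thesis
    unfolding rotational_map_def [abs_def]
    by (intro has_derivative_vector2 has_derivative_first_coordinate
        smooth_on_DERIV [OF smooth sphere_chart_D [OF assms]])
qed

lemmas rotational_map_differential =
  frechet_derivative_at [OF rotational_map_has_derivative, symmetric]

lemma rotational_map_1: "rotational_map \<rho> k x $ 1 = \<rho> (x $ 1)"
  by (simp add: rotational_map_def vector_2)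

lemma smooth_map_rotational:
  assumes "I \<noteq> {}"
  shows "smooth_map (sphere_chart I) sphere_metric target_chart target_metric (rotational_map \<rho> k)"
proof -
  note U = open_sphere_chart [OF I]
  have "vector [pi / 2, \<theta>] \<in> sphere_chart I" if "\<theta> \<in> I" for \<theta>
    using that by (simp add: sphere_chart_def vector_2)
  then have "sphere_chart I \<noteq> {}" using assms by blast
  moreover have "0 < (sin s)\<^sup>2" if "s \<in> {0<..<pi}" for s :: real
    using sin_pos_on [OF that] by simp
  ultimately have "riemannian_chart (sphere_chart I) sphere_metric"
    unfolding sphere_metric_warped
    by (intro riemannian_chart_warped [where J = "{0<..<pi}", OF U] sphere_chart_D
        smooth_on_power smooth_on_sin) auto
  moreover have "riemannian_chart target_chart target_metric"
  proof -
    have "(vector [1, 0] :: real^2) \<in> target_chart" by (simp add: target_chart_def vector_2)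
    then have "target_chart \<noteq> {}" by blast
    then show ?thesis
      unfolding target_metric_warped
      by (intro riemannian_chart_warped [where J = "{0<..}"] smooth_on_bounded_linear bounded_linear_ident)
         (auto simp: target_chart_def intro!: open_Collect_less continuous_intros)
  qed
  moreover have "smooth_on (sphere_chart I) (rotational_map \<rho> k)"
  proof -
    have "smooth_on (sphere_chart I) (\<lambda>x. \<rho> (x $ 1) *\<^sub>R (axis 1 1 :: real^2))"
      by (rule smooth_on_compose_linear [where J = "{0<..<pi}", OF U bounded_linear_vec_nth _ smooth])
         (auto dest: sphere_chart_D)
    moreover have "bounded_linear (\<lambda>x :: real^2. (k * x $ 2) *\<^sub>R (axis 2 1 :: real^2))"
      by (intro bounded_linear_compose [OF bounded_linear_scaleR_left]
          bounded_linear_const_mult bounded_linear_vec_nth)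
    ultimately have "smooth_on (sphere_chart I)
        (\<lambda>x. \<rho> (x $ 1) *\<^sub>R axis 1 1 + (k * x $ 2) *\<^sub>R (axis 2 1 :: real^2))"
      by (rule smooth_on_add [OF U _ smooth_on_bounded_linear [OF U]])
    then show ?thesis
      by (simp add: rotational_map_def [abs_def] vector2_eq)
  qed
  moreover have "rotational_map \<rho> k ` sphere_chart I \<subseteq> target_chart"
    using pos sphere_chart_D by (auto simp: target_chart_def rotational_map_1)
  ultimately show ?thesis by (simp add: smooth_map_def)
qed

text \<open>
  Every section met below has components that depend on the polar distance only, so the tension,
  the gradient term and both steps of the rough Laplacian are instances of this formula.
\<close>

lemma pullback_covariant_radial_field:
  assumes x: "x \<in> sphere_chart I"
    and V: "\<And>y. y \<in> sphere_chart I \<Longrightarrow> V y = vector [a (y $ 1), b (y $ 1)]"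
    and a: "(a has_real_derivative a') (at (x $ 1))" and b: "(b has_real_derivative b') (at (x $ 1))"
  shows "pullback_covariant target_metric (rotational_map \<rho> k) u V x
    = vector [a' * u $ 1 - k * u $ 2 * b (x $ 1) / 2,
        b' * u $ 1 + (deriv \<rho> (x $ 1) * u $ 1 * b (x $ 1) + k * u $ 2 * a (x $ 1)) / (2 * \<rho> (x $ 1))]"
proof -
  have "(V has_derivative (\<lambda>v. vector [a' * v $ 1, b' * v $ 1])) (at x)"
    by (rule has_derivative_transform_within_open [OF has_derivative_radial_field [OF a b]
          open_sphere_chart [OF I] x]) (simp add: V)
  from frechet_derivative_at [OF this, symmetric] show ?thesis
    using pos [OF sphere_chart_D [OF x]]
    by (simp add: pullback_covariant_def rotational_map_differential [OF x] V [OF x]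
        target_connection_form rotational_map_1 vec_eq_iff forall_2 vector_2)
qed

lemma tension_rotational:
  assumes x: "x \<in> sphere_chart I"
  shows "tension sphere_metric target_metric (rotational_map \<rho> k) x
    = vector [tension_profile \<rho> k (x $ 1), 0]"
proof -
  have d2: "(deriv \<rho> has_real_derivative deriv (deriv \<rho>) (x $ 1)) (at (x $ 1))"
    by (rule smooth_on_DERIV_deriv [OF _ smooth sphere_chart_D [OF x]]) simp
  have hessian: "pullback_covariant target_metric (rotational_map \<rho> k) u
        (\<lambda>y. frechet_derivative (rotational_map \<rho> k) (at y) v) x
      = vector [deriv (deriv \<rho>) (x $ 1) * v $ 1 * u $ 1 - k * u $ 2 * (k * v $ 2) / 2,
        0 * u $ 1 + (deriv \<rho> (x $ 1) * u $ 1 * (k * v $ 2) + k * u $ 2 * (deriv \<rho> (x $ 1) * v $ 1))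
          / (2 * \<rho> (x $ 1))]" for u v
    by (rule pullback_covariant_radial_field [OF x, where a = "\<lambda>r. deriv \<rho> r * v $ 1" and b = "\<lambda>r. k * v $ 2"])
       (auto simp: rotational_map_differential intro: DERIV_cmult_right [OF d2])
  show ?thesis
    using sin_pos_on [OF sphere_chart_D [OF x]]
    unfolding tension_def second_fundamental_form_def sphere_trace [OF x] hessian
      sphere_covariant_const [OF x] rotational_map_differential [OF x] tension_profile_def
      radial_laplacian_def
    by (simp add: vec_eq_iff forall_2 vector_2 axis_def field_simps power2_eq_square)
qed

lemma pullback_covariant_tension:
  assumes x: "x \<in> sphere_chart I"
  shows "pullback_covariant target_metric (rotational_map \<rho> k) u
      (tension sphere_metric target_metric (rotational_map \<rho> k)) x
    = vector [deriv (tension_profile \<rho> k) (x $ 1) * u $ 1,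
        k * u $ 2 * tension_profile \<rho> k (x $ 1) / (2 * \<rho> (x $ 1))]"
  using pullback_covariant_radial_field [OF x tension_rotational
      smooth_on_DERIV [OF smooth_on_tension_profile [OF smooth] sphere_chart_D [OF x]] DERIV_const, of u]
  by simp

text \<open>
  Differentiating the tension twice in the angular direction gives \<open>- k\<^sup>2 X / (4 \<rho>)\<close>: the first
  derivative turns the radial field into an angular one, and the second turns it back. The
  curvature term, with Gauss curvature \<open>1 / (4 \<rho>\<^sup>2)\<close> and angular velocity of squared length
  \<open>k\<^sup>2 \<rho>\<close>, has the same value, and the bitension field is their difference. Only the radial
  Laplacian remains.
\<close>

lemma bitension_rotational:
  assumes x: "x \<in> sphere_chart I"
  shows "bitension sphere_metric target_metric (rotational_map \<rho> k) x
    = vector [radial_laplacian (tension_profile \<rho> k) (x $ 1), 0]"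
proof -
  define X where "X = tension_profile \<rho> k"
  have X: "smooth_on {0<..<pi} X"
    unfolding X_def by (rule smooth_on_tension_profile [OF smooth])
  have r: "x $ 1 \<in> {0<..<pi}" by (rule sphere_chart_D [OF x])
  have d2: "(deriv X has_real_derivative deriv (deriv X) (x $ 1)) (at (x $ 1))"
    by (rule smooth_on_DERIV_deriv [OF _ X r]) simp
  have \<rho>: "0 < \<rho> (x $ 1)" by (rule pos [OF r])
  have d: "((\<lambda>r. k * c * X r / (2 * \<rho> r)) has_real_derivative
      (k * c * deriv X (x $ 1) * \<rho> (x $ 1) - k * c * X (x $ 1) * deriv \<rho> (x $ 1)) / (2 * (\<rho> (x $ 1))\<^sup>2))
      (at (x $ 1))" for c
    using \<rho>
    by (auto intro!: derivative_eq_intros smooth_on_DERIV [OF X r] smooth_on_DERIV [OF smooth r]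
        simp: field_simps power2_eq_square)
  have second: "pullback_covariant target_metric (rotational_map \<rho> k) u
      (\<lambda>y. pullback_covariant target_metric (rotational_map \<rho> k) v
        (tension sphere_metric target_metric (rotational_map \<rho> k)) y) x
     = vector [deriv (deriv X) (x $ 1) * v $ 1 * u $ 1 - k * u $ 2 * (k * v $ 2 * X (x $ 1) / (2 * \<rho> (x $ 1))) / 2,
       (k * v $ 2 * deriv X (x $ 1) * \<rho> (x $ 1) - k * v $ 2 * X (x $ 1) * deriv \<rho> (x $ 1)) / (2 * (\<rho> (x $ 1))\<^sup>2) * u $ 1
       + (deriv \<rho> (x $ 1) * u $ 1 * (k * v $ 2 * X (x $ 1) / (2 * \<rho> (x $ 1))) + k * u $ 2 * (deriv X (x $ 1) * v $ 1))
          / (2 * \<rho> (x $ 1))]" for u v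
    by (rule pullback_covariant_radial_field [OF x, where a = "\<lambda>r. deriv X r * v $ 1"
          and b = "\<lambda>r. k * v $ 2 * X r / (2 * \<rho> r)"])
       (auto simp: pullback_covariant_tension X_def [symmetric] intro: DERIV_cmult_right [OF d2] d)
  have curv: "curvature target_metric (rotational_map \<rho> k x) u v w
    = ((u $ 1 * v $ 2 - u $ 2 * v $ 1) / (4 * (\<rho> (x $ 1))\<^sup>2)) *\<^sub>R vector [\<rho> (x $ 1) * w $ 2, - w $ 1]" for u v w
    using target_curvature [of "rotational_map \<rho> k x"] \<rho> by (simp add: rotational_map_1)
  show ?thesis
    using sin_pos_on [OF r] \<rho>
    unfolding bitension_def rough_laplacian_def sphere_trace [OF x] second curv
      pullback_covariant_tension [OF x] sphere_covariant_const [OF x] rotational_map_differential [OF x]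
      tension_rotational [OF x] X_def [symmetric] radial_laplacian_def
    by (simp add: vec_eq_iff forall_2 vector_2 axis_def field_simps power2_eq_square)
qed

lemma harmonic_rotational_iff:
  assumes "I \<noteq> {}"
  shows "harmonic (sphere_chart I) sphere_metric target_chart target_metric (rotational_map \<rho> k)
    \<longleftrightarrow> (\<forall>r\<in>{0<..<pi}. tension_profile \<rho> k r = 0)"
  using smooth_map_rotational [OF assms]
  by (simp add: harmonic_def tension_rotational vec_eq_iff forall_2 vector_2
      sphere_chart_all_iff [OF assms, where P = "\<lambda>r. tension_profile \<rho> k r = 0"] del: greaterThanLessThan_iff)

lemma biharmonic_rotational_iff:
  assumes "I \<noteq> {}"
  shows "biharmonic (sphere_chart I) sphere_metric target_chart target_metric (rotational_map \<rho> k)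
    \<longleftrightarrow> (\<forall>r\<in>{0<..<pi}. radial_laplacian (tension_profile \<rho> k) r = 0)"
  using smooth_map_rotational [OF assms]
  by (simp add: biharmonic_def bitension_rotational vec_eq_iff forall_2 vector_2
      sphere_chart_all_iff [OF assms, where P = "\<lambda>r. radial_laplacian (tension_profile \<rho> k) r = 0"]
      del: greaterThanLessThan_iff)

text \<open>
  The three terms \<open>f L X\<close>, \<open>L f X\<close> and \<open>2 f' X'\<close> of the equation are those of the
  product rule for \<open>L (f X)\<close>.
\<close>

lemma f_biharmonic_rotational_iff:
  assumes "I \<noteq> {}" and f: "smooth_on {0<..<pi} f" "\<And>r. r \<in> {0<..<pi} \<Longrightarrow> 0 < f r"
  shows "f_biharmonic (sphere_chart I) sphere_metric target_chart target_metric
      (\<lambda>x. f (x $ 1)) (rotational_map \<rho> k)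
    \<longleftrightarrow> (\<forall>r\<in>{0<..<pi}. radial_laplacian (\<lambda>r. f r * tension_profile \<rho> k r) r = 0)"
proof -
  have "smooth_on (sphere_chart I) (\<lambda>x. f (x $ 1) *\<^sub>R (1::real))"
    by (intro smooth_on_compose_linear [where J = "{0<..<pi}"] open_sphere_chart I f bounded_linear_vec_nth)
       (auto dest: sphere_chart_D)
  then have sf: "smooth_on (sphere_chart I) (\<lambda>x. f (x $ 1))" by simp
  have "f (x $ 1) *\<^sub>R bitension sphere_metric target_metric (rotational_map \<rho> k) x
      + laplacian sphere_metric (\<lambda>x. f (x $ 1)) x *\<^sub>R tension sphere_metric target_metric (rotational_map \<rho> k) x
      + 2 *\<^sub>R pullback_covariant target_metric (rotational_map \<rho> k) (gradient sphere_metric (\<lambda>x. f (x $ 1)) x)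
          (tension sphere_metric target_metric (rotational_map \<rho> k)) x
    = vector [radial_laplacian (\<lambda>r. f r * tension_profile \<rho> k r) (x $ 1), 0]"
    if x: "x \<in> sphere_chart I" for x
  proof -
    have r: "x $ 1 \<in> {0<..<pi}" by (rule sphere_chart_D [OF x])
    have g: "gradient sphere_metric (\<lambda>x. f (x $ 1)) x = vector [deriv f (x $ 1), 0]"
      unfolding sphere_metric_warped
      by (rule gradient_warped [where f = f, OF _ smooth_on_DERIV [OF f(1) r]]) (use sin_pos_on [OF r] in simp)
    show ?thesis
      unfolding g bitension_rotational [OF x] tension_rotational [OF x] pullback_covariant_tension [OF x]
        sphere_laplacian_radial [OF I f(1) x]
        radial_laplacian_mult [OF f(1) smooth_on_tension_profile [OF smooth] r]
      by (simp add: vec_eq_iff forall_2 vector_2)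
  qed
  then show ?thesis
    using smooth_map_rotational [OF assms(1)] sf f(2)
    by (simp add: f_biharmonic_def vec_eq_iff forall_2 vector_2 sphere_chart_D
        sphere_chart_all_iff [OF assms(1), where P = "\<lambda>r. radial_laplacian (\<lambda>r. f r * tension_profile \<rho> k r) r = 0"]
        del: greaterThanLessThan_iff)
qed

end

section \<open>Classification of the profiles and a proper example\<close>

theorem proposition2p11:
  fixes k :: real and f :: "real \<Rightarrow> real" and I :: "real set"
  assumes f: "\<forall>r. 0 < r \<and> r < pi \<longrightarrow> f r = (sin r)^2 / (1 + (ln (tan (r / 2)))^2)^2"
    and I: "open I" "is_interval I" "I \<noteq> {}"
  shows "(\<forall>\<rho>. smooth_on {0<..<pi} \<rho> \<and> (\<forall>r\<in>{0<..<pi}. 0 < \<rho> r) \<longrightarrow>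
           (f_biharmonic (sphere_chart I) sphere_metric target_chart target_metric
              (\<lambda>x. f (x $ 1)) (rotational_map \<rho> k) \<longleftrightarrow>
            (\<exists>C\<^sub>1 C\<^sub>2 C\<^sub>3 C\<^sub>4 :: real. \<forall>r\<in>{0<..<pi}.
               \<rho> r = C\<^sub>4 + C\<^sub>3 * ln (tan (r / 2))
                 + (C\<^sub>1 / 2 + k^2 / 4) * (ln (tan (r / 2)))^2
                 + C\<^sub>2 / 6 * (ln (tan (r / 2)))^3
                 + C\<^sub>1 / 6 * (ln (tan (r / 2)))^4
                 + C\<^sub>2 / 10 * (ln (tan (r / 2)))^5
                 + C\<^sub>1 / 30 * (ln (tan (r / 2)))^6
                 + C\<^sub>2 / 42 * (ln (tan (r / 2)))^7)))
       \<and> proper_f_biharmonic (sphere_chart I) sphere_metric target_chart target_metric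
           (\<lambda>x. f (x $ 1))
           (rotational_map
              (\<lambda>r. 1 / 30 * (ln (tan (r / 2)))^6 + 1 / 6 * (ln (tan (r / 2)))^4
                 + (1 / 2 + 1 / 4 * k^2) * (ln (tan (r / 2)))^2 + 1) k)"
proof -
  have f': "f r = (sin r)\<^sup>2 / (1 + (mercator r)\<^sup>2)\<^sup>2" if "r \<in> {0<..<pi}" for r
    using f that by (simp add: mercator_def)
  have weight_pos: "0 < (1 + (mercator r)\<^sup>2)\<^sup>2" for r
    by (intro zero_less_power add_pos_nonneg) auto
  have "smooth_on {0<..<pi} (\<lambda>r. (sin r)\<^sup>2 / (1 + (mercator r)\<^sup>2)\<^sup>2)"
    using weight_pos less_irrefl
    by (intro smooth_on_divide smooth_on_add smooth_on_power smooth_on_const smooth_on_mercator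
        smooth_on_sin) fastforce+
  then have f_smooth: "smooth_on {0<..<pi} f"
    by (rule smooth_on_cong [OF open_greaterThanLessThan]) (simp add: f')
  have f_pos: "0 < f r" if "r \<in> {0<..<pi}" for r
    using sin_pos_on [OF that] weight_pos by (simp add: f' [OF that])
  have characterisation: "f_biharmonic (sphere_chart I) sphere_metric target_chart target_metric
        (\<lambda>x. f (x $ 1)) (rotational_map \<rho> k) \<longleftrightarrow>
      (\<exists>a b c d. \<forall>r\<in>{0<..<pi}. \<rho> r = d + c * mercator r + profile k a b (mercator r))"
    if "smooth_on {0<..<pi} \<rho>" "\<And>r. r \<in> {0<..<pi} \<Longrightarrow> 0 < \<rho> r" for \<rho>
    using f_biharmonic_rotational_iff [OF I(1) that I(3) f_smooth f_pos]
      weighted_tension_harmonic_iff [OF f' f_smooth that(1)] by simp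

  \<comment> \<open>The example is the member \<open>C\<^sub>1 = C\<^sub>4 = 1\<close>, \<open>C\<^sub>2 = C\<^sub>3 = 0\<close> of the family.\<close>
  let ?\<rho> = "\<lambda>r. 1 + profile k 1 0 (mercator r)"
  have \<rho>_smooth: "smooth_on {0<..<pi} ?\<rho>"
    by (intro smooth_on_add smooth_on_const smooth_on_profile) simp_all
  have \<rho>_pos: "0 < ?\<rho> r" for r
    by (auto simp: profile_def intro!: add_pos_nonneg)
  have X: "tension_profile ?\<rho> k r = (1 + (mercator r)\<^sup>2)\<^sup>2 / (sin r)\<^sup>2" if "r \<in> {0<..<pi}" for r
  proof -
    have "radial_laplacian (\<lambda>r. ?\<rho> r - profile k 1 0 (mercator r)) r = 0"
      using radial_laplacian_eq_0_iff [of "\<lambda>r. 1"] that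
      by (auto simp: smooth_on_const intro: exI [of _ 1] exI [of _ 0])
    then have "radial_laplacian ?\<rho> r = (k\<^sup>2 / 2 + (1 + (mercator r)\<^sup>2)\<^sup>2) / (sin r)\<^sup>2"
      using radial_laplacian_diff [OF \<rho>_smooth smooth_on_profile that, of k 1 0]
      by (simp add: radial_laplacian_profile [OF that])
    then show ?thesis
      by (simp add: tension_profile_def add_divide_distrib)
  qed
  \<comment> \<open>At the equator both \<open>t\<close> and \<open>cos r\<close> vanish, so it suffices to know \<open>X''\<close> there.\<close>
  have equator: "pi / 2 \<in> {0<..<pi}" "mercator (pi / 2) = 0"
    by (auto simp: mercator_def tan_45)
  have "radial_laplacian (tension_profile ?\<rho> k) (pi / 2)
      = radial_laplacian (\<lambda>r. (1 + (mercator r)\<^sup>2)\<^sup>2 / (sin r)\<^sup>2) (pi / 2)"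
    by (rule radial_laplacian_cong [OF X equator(1)])
  also have "\<dots> = 6 + cos (pi / 2) / sin (pi / 2)
      * ((4 * mercator (pi / 2) * (1 + (mercator (pi / 2))\<^sup>2)
          - 2 * (1 + (mercator (pi / 2))\<^sup>2)\<^sup>2 * cos (pi / 2)) / (sin (pi / 2)) ^ 3)"
  proof (rule radial_laplacian_eqI [OF _ equator(1)])
    show "((\<lambda>r. (1 + (mercator r)\<^sup>2)\<^sup>2 / (sin r)\<^sup>2) has_real_derivative
        (4 * mercator r * (1 + (mercator r)\<^sup>2) - 2 * (1 + (mercator r)\<^sup>2)\<^sup>2 * cos r) / (sin r) ^ 3) (at r)"
      if "r \<in> {0<..<pi}" for r
      using sin_pos_on [OF that]
      by (auto intro!: derivative_eq_intros DERIV_mercator [OF that]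
          simp: field_simps power2_eq_square power3_eq_cube)
    show "((\<lambda>r. (4 * mercator r * (1 + (mercator r)\<^sup>2) - 2 * (1 + (mercator r)\<^sup>2)\<^sup>2 * cos r) / (sin r) ^ 3)
        has_real_derivative 6) (at (pi / 2))"
      by (auto intro!: derivative_eq_intros DERIV_mercator [OF equator(1)] simp: equator(2))
  qed
  finally have "radial_laplacian (tension_profile ?\<rho> k) (pi / 2) = 6" by simp
  then have "\<not> biharmonic (sphere_chart I) sphere_metric target_chart target_metric (rotational_map ?\<rho> k)"
    using biharmonic_rotational_iff [OF I(1) \<rho>_smooth \<rho>_pos I(3)] equator(1) by fastforce
  moreover have "tension_profile ?\<rho> k (pi / 2) = 1"
    by (simp add: X [OF equator(1)] equator(2))
  then have "\<not> harmonic (sphere_chart I) sphere_metric target_chart target_metric (rotational_map ?\<rho> k)"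
    using harmonic_rotational_iff [OF I(1) \<rho>_smooth \<rho>_pos I(3)] equator(1) by fastforce
  moreover have "f_biharmonic (sphere_chart I) sphere_metric target_chart target_metric
      (\<lambda>x. f (x $ 1)) (rotational_map ?\<rho> k)"
    unfolding characterisation [OF \<rho>_smooth \<rho>_pos]
    by (intro exI [of _ 1] exI [of _ 0]) simp
  ultimately have proper: "proper_f_biharmonic (sphere_chart I) sphere_metric target_chart target_metric
      (\<lambda>x. f (x $ 1)) (rotational_map ?\<rho> k)"
    by (simp add: proper_f_biharmonic_def)
  have "?\<rho> = (\<lambda>r. 1 / 30 * (ln (tan (r / 2)))^6 + 1 / 6 * (ln (tan (r / 2)))^4
      + (1 / 2 + 1 / 4 * k^2) * (ln (tan (r / 2)))^2 + 1)"
    by (simp add: fun_eq_iff profile_def mercator_def algebra_simps)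
  with proper show ?thesis
    using characterisation by (simp add: profile_def mercator_def add.assoc)
qed

end
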